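(* Let $\phi\colon U_S\to W$ be a representation over a field $\Bbbk$ of a matroid $\mathbf M$ on a finite set $S$, and let $I\subseteq S$. Then $S_I(\phi)\neq0$ if and only if $I$ is a connected T-flat of $\mathbf M$.
   Context: $U_S$ is the $\Bbbk$-vector space with basis $\{e_a: a\in S\}$, $W$ is a $\Bbbk$-vector space, $\phi$ is linear; for $I\subseteq S$, $V_I$ is the span of $\{\phi(e_a):a\in I\}$. $\phi$ is a representation of $\mathbf M$ if $A\subseteq S$ is independent in $\mathbf M$ iff $\dim V_A=|A|$. $r_A$ is the rank and $\ell_A=|A|-r_A-1$ the level of $A$. A T-flat of $\mathbf M$ is a subset $A\subseteq S$ such that $S\setminus A$ is a proper flat of the dual matroid $\mathbf M^*$ (equivalently, $A$ is a nonempty union of circuits). For $n\ge0$, $\mathcal T_n(\mathbf M)$ is the set of T-flats of level $n$. A subset $I$ is connected in $\mathbf M$ if the restriction $\mathbf M|I$ is a connected matroid, i.e. $I$ is not a disjoint union of two nonempty subsets $I_1,I_2$ with $r_I=r_{I_1}+r_{I_2}$. Multiplicity space $S_I(\phi)$: if $I$ is not a T-flat, $S_I(\phi)=0$. For a T-flat $I$ of level $n$, $C(I)$ is the set of chains $\mathbb I=(I^{(0)}\subsetneq\dots\subsetneq I^{(n)}=I)$ with $I^{(i)}\in\mathcal T_i(\mathbf M)$; $V(\mathbb I)=\Bbbk=S_0W$ if $n=0$, and $V(\mathbb I)=\prod_{i=1}^n\bigl(V_{I^{(i)}\setminus I^{(i-1)}}\cap V_{I^{(i-1)}}\bigr)\subseteq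 S_nW$ (product of subspaces in the symmetric algebra of $W$, landing in the $n$th symmetric power) if $n\ge1$; and $S_I(\phi)=\sum_{\mathbb I\in C(I)}V(\mathbb I)$. *)

theory Defs
  imports "HOL-Algebra.QuotRing" "HOL-Algebra.Algebraic_Closure_Type" "HOL-Library.Poly_Mapping"
begin

section \<open>Matroids\<close>

locale matroid =
  fixes S :: "'a set" and indep :: "'a set \<Rightarrow> bool"
  assumes finite_ground: "finite S"
    and indep_subset_ground: "indep A \<Longrightarrow> A \<subseteq> S"
    and indep_empty: "indep {}"
    and indep_subset: "indep A \<Longrightarrow> B \<subseteq> A \<Longrightarrow> indep B"
    and indep_augment: "indep A \<Longrightarrow> indep B \<Longrightarrow> card A < card B \<Longrightarrow> \<exists>x\<in>B - A. indep (insert x A)"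

definition rank :: "('a set \<Rightarrow> bool) \<Rightarrow> 'a set \<Rightarrow> nat" where
  "rank indep A = Max (card ` {Y. Y \<subseteq> A \<and> indep Y})"

definition matroid_basis :: "'a set \<Rightarrow> ('a set \<Rightarrow> bool) \<Rightarrow> 'a set \<Rightarrow> bool" where
  "matroid_basis S indep B \<longleftrightarrow> indep B \<and> (\<forall>Y\<subseteq>S. indep Y \<longrightarrow> B \<subseteq> Y \<longrightarrow> Y = B)"

text \<open>The bases of the dual matroid are the complements of the bases.\<close>
definition dual_indep :: "'a set \<Rightarrow> ('a set \<Rightarrow> bool) \<Rightarrow> 'a set \<Rightarrow> bool" where
  "dual_indep S indep A \<longleftrightarrow> (\<exists>B. matroid_basis S indep B \<and> A \<subseteq> S - B)"

definition flat :: "'a set \<Rightarrow> ('a set \<Rightarrow> bool) \<Rightarrow> 'a set \<Rightarrow> bool" where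
  "flat S indep F \<longleftrightarrow> F \<subseteq> S \<and> (\<forall>x\<in>S - F. rank indep F < rank indep (insert x F))"

definition T_flat :: "'a set \<Rightarrow> ('a set \<Rightarrow> bool) \<Rightarrow> 'a set \<Rightarrow> bool" where
  "T_flat S indep A \<longleftrightarrow> A \<subseteq> S \<and> flat S (dual_indep S indep) (S - A) \<and> S - A \<noteq> S"

definition level :: "('a set \<Rightarrow> bool) \<Rightarrow> 'a set \<Rightarrow> int" where
  "level indep A = int (card A) - int (rank indep A) - 1"

definition T_flats :: "'a set \<Rightarrow> ('a set \<Rightarrow> bool) \<Rightarrow> nat \<Rightarrow> 'a set set" where
  "T_flats S indep n = {A. T_flat S indep A \<and> level indep A = int n}"

text \<open>The rank of a subset of \<open>I\<close> is the same in the matroid and in its restriction to \<open>I\<close>.\<close>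
definition connected_in :: "('a set \<Rightarrow> bool) \<Rightarrow> 'a set \<Rightarrow> bool" where
  "connected_in indep I \<longleftrightarrow>
     \<not> (\<exists>I1 I2. I1 \<noteq> {} \<and> I2 \<noteq> {} \<and> I1 \<inter> I2 = {} \<and> I1 \<union> I2 = I \<and>
          rank indep I = rank indep I1 + rank indep I2)"


section \<open>Representations\<close>

text \<open>Together with \<^term>\<open>vector_space scaleU\<close>: the whole space is \<open>U\<^sub>S\<close>, with basis
  the vectors \<open>e a\<close> for \<open>a \<in> S\<close>.\<close>
definition indexed_basis ::
  "('k::field \<Rightarrow> 'u::ab_group_add \<Rightarrow> 'u) \<Rightarrow> 'a set \<Rightarrow> ('a \<Rightarrow> 'u) \<Rightarrow> bool" where
  "indexed_basis scaleU S e \<longleftrightarrow>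
     inj_on e S \<and> \<not> module.dependent scaleU (e ` S) \<and> module.span scaleU (e ` S) = UNIV"

definition V_sub ::
  "('k::field \<Rightarrow> 'w::ab_group_add \<Rightarrow> 'w) \<Rightarrow> ('a \<Rightarrow> 'u) \<Rightarrow> ('u \<Rightarrow> 'w) \<Rightarrow> 'a set \<Rightarrow> 'w set" where
  "V_sub scaleW e \<phi> I = module.span scaleW {\<phi> (e a) |a. a \<in> I}"

definition is_representation ::
  "'a set \<Rightarrow> ('a set \<Rightarrow> bool) \<Rightarrow> ('k::field \<Rightarrow> 'w::ab_group_add \<Rightarrow> 'w) \<Rightarrow> ('a \<Rightarrow> 'u) \<Rightarrow> ('u \<Rightarrow> 'w) \<Rightarrow> bool" where
  "is_representation S indep scaleW e \<phi> \<longleftrightarrow>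
     (\<forall>A\<subseteq>S. indep A \<longleftrightarrow> vector_space.dim scaleW (V_sub scaleW e \<phi> A) = card A)"


section \<open>The symmetric algebra\<close>

text \<open>\<open>Sym W\<close> is the polynomial ring with one variable for each vector \<open>w\<close> of \<open>W\<close>, modulo the
  ideal generated by the relations that make \<^term>\<open>w\<close> \<open>\<mapsto>\<close> (class of its variable) linear.\<close>

type_synonym ('w, 'k) vec_poly = "('w \<Rightarrow>\<^sub>0 nat) \<Rightarrow>\<^sub>0 'k"

definition poly_var :: "'w \<Rightarrow> ('w, 'k::field) vec_poly" where
  "poly_var w = Poly_Mapping.single (Poly_Mapping.single w 1) 1"

definition poly_const :: "'k \<Rightarrow> ('w, 'k::field) vec_poly" where
  "poly_const c = Poly_Mapping.single 0 c"

definition sym_ideal :: "('k::field \<Rightarrow> 'w::ab_group_add \<Rightarrow> 'w) \<Rightarrow> ('w, 'k) vec_poly set" where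
  "sym_ideal scale = genideal ring_of_type_algebra
     ({poly_var (v + w) - poly_var v - poly_var w |v w. True} \<union>
      {poly_var (scale c w) - poly_const c * poly_var w |c w. True})"

definition Sym :: "('k::field \<Rightarrow> 'w::ab_group_add \<Rightarrow> 'w) \<Rightarrow> ('w, 'k) vec_poly set ring" where
  "Sym scale = ring_of_type_algebra Quot sym_ideal scale"

definition sym_class ::
  "('k::field \<Rightarrow> 'w::ab_group_add \<Rightarrow> 'w) \<Rightarrow> ('w, 'k) vec_poly \<Rightarrow> ('w, 'k) vec_poly set" where
  "sym_class scale p = sym_ideal scale +>\<^bsub>ring_of_type_algebra\<^esub> p"

text \<open>The scalar \<open>c\<close> acts as multiplication by the class of the constant \<open>c\<close>.\<close>
inductive_set sym_span ::
  "('k::field \<Rightarrow> 'w::ab_group_add \<Rightarrow> 'w) \<Rightarrow> ('w, 'k) vec_poly set set \<Rightarrow> ('w, 'k) vec_poly set set"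
  for scale :: "'k::field \<Rightarrow> 'w::ab_group_add \<Rightarrow> 'w" and Y :: "('w, 'k) vec_poly set set" where
  sym_span_zero: "\<zero>\<^bsub>Sym scale\<^esub> \<in> sym_span scale Y"
| sym_span_step: "x \<in> Y \<Longrightarrow> y \<in> sym_span scale Y \<Longrightarrow>
    (sym_class scale (poly_const c) \<otimes>\<^bsub>Sym scale\<^esub> x) \<oplus>\<^bsub>Sym scale\<^esub> y \<in> sym_span scale Y"

definition subspace_prod ::
  "('k::field \<Rightarrow> 'w::ab_group_add \<Rightarrow> 'w) \<Rightarrow> ('w, 'k) vec_poly set set \<Rightarrow> ('w, 'k) vec_poly set set
     \<Rightarrow> ('w, 'k) vec_poly set set" where
  "subspace_prod scale P Q = sym_span scale {p \<otimes>\<^bsub>Sym scale\<^esub> q |p q. p \<in> P \<and> q \<in> Q}"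

text \<open>The empty product is the line of constants \<open>S\<^sub>0 W\<close>.\<close>
definition subspace_prod_list ::
  "('k::field \<Rightarrow> 'w::ab_group_add \<Rightarrow> 'w) \<Rightarrow> ('w, 'k) vec_poly set set list \<Rightarrow> ('w, 'k) vec_poly set set" where
  "subspace_prod_list scale Ps = foldr (subspace_prod scale) Ps (sym_span scale {\<one>\<^bsub>Sym scale\<^esub>})"


section \<open>Multiplicity spaces\<close>

text \<open>A chain \<open>I\<^sup>(\<^sup>0\<^sup>) \<subset> \<dots> \<subset> I\<^sup>(\<^sup>n\<^sup>) = I\<close> is the list of its \<open>n + 1\<close> members.\<close>
definition chains :: "'a set \<Rightarrow> ('a set \<Rightarrow> bool) \<Rightarrow> 'a set \<Rightarrow> 'a set list set" where
  "chains S indep I =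
     {Is. \<exists>n. level indep I = int n \<and> length Is = n + 1 \<and>
          (\<forall>i\<le>n. Is ! i \<in> T_flats S indep i) \<and>
          (\<forall>i<n. Is ! i \<subset> Is ! (i + 1)) \<and> Is ! n = I}"

definition chain_space ::
  "('k::field \<Rightarrow> 'w::ab_group_add \<Rightarrow> 'w) \<Rightarrow> ('a \<Rightarrow> 'u) \<Rightarrow> ('u \<Rightarrow> 'w) \<Rightarrow> 'a set list
     \<Rightarrow> ('w, 'k) vec_poly set set" where
  "chain_space scaleW e \<phi> Is =
     subspace_prod_list scaleW
       (map (\<lambda>i. (\<lambda>w. sym_class scaleW (poly_var w)) `
               (V_sub scaleW e \<phi> (Is ! i - Is ! (i - 1)) \<inter> V_sub scaleW e \<phi> (Is ! (i - 1))))
          [1..<length Is])"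

definition multiplicity_space ::
  "'a set \<Rightarrow> ('a set \<Rightarrow> bool) \<Rightarrow> ('k::field \<Rightarrow> 'w::ab_group_add \<Rightarrow> 'w) \<Rightarrow> ('a \<Rightarrow> 'u) \<Rightarrow> ('u \<Rightarrow> 'w)
     \<Rightarrow> 'a set \<Rightarrow> ('w, 'k) vec_poly set set" where
  "multiplicity_space S indep scaleW e \<phi> I =
     (if T_flat S indep I
      then sym_span scaleW (\<Union>Is\<in>chains S indep I. chain_space scaleW e \<phi> Is)
      else {\<zero>\<^bsub>Sym scaleW\<^esub>})"

end

theory Submission
  imports Defs
begin

text \<open>
  The symmetric algebra of \<open>W\<close> has no zero divisors among products of vectors: such a product is
  detected by mapping \<open>W\<close> linearly to \<open>k[x]\<close>, injectively on a finite-dimensional subspace containing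
  the factors. Hence the space of a chain of T-flats is nonzero iff
  \<open>V\<^bsub>K - J\<^esub> \<inter> V\<^bsub>J\<^esub> \<noteq> 0\<close>, that is \<open>r(K) < r(K - J) + r(J)\<close>, for all consecutive members \<open>J \<subset> K\<close>.
  Such a chain is an ear decomposition of \<open>I\<close>. It starts with a circuit, which is connected, and
  connectedness passes from \<open>J\<close> to \<open>K\<close>: if \<open>K = A \<union> B\<close> is a separation with \<open>J \<subseteq> A\<close>, then \<open>B\<close> has
  positive nullity, which forces \<open>A = J\<close>. Conversely, a connected T-flat \<open>I\<close> properly containing \<open>J\<close>
  contains a minimal \<open>D\<close> disjoint from \<open>J\<close> with \<open>r(J \<union> D) < r(J) + r(D)\<close>, and \<open>J \<union> D\<close> is a T-flat
  of the next level, so that the chain can be extended up to \<open>I\<close>.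
\<close>

section \<open>Rank and nullity\<close>

context matroid
begin

lemma finite_sub: "A \<subseteq> S \<Longrightarrow> finite A"
  using finite_ground finite_subset by blast

lemma finite_indep: "indep A \<Longrightarrow> finite A"
  using indep_subset_ground finite_sub by blast

lemma card_le_rank:
  assumes "A \<subseteq> S" "Y \<subseteq> A" "indep Y"
  shows "card Y \<le> rank indep A"
proof -
  have "finite {Y. Y \<subseteq> A \<and> indep Y}"
    using finite_sub[OF assms(1)] by simp
  then show ?thesis unfolding rank_def using assms by (intro Max_ge) auto
qed

lemma rank_attained:
  assumes "A \<subseteq> S"
  shows "\<exists>Y\<subseteq>A. indep Y \<and> card Y = rank indep A"
proof -
  have "finite {Y. Y \<subseteq> A \<and> indep Y}"
    using finite_sub[OF assms(1)] by simp
  moreover have "{} \<in> {Y. Y \<subseteq> A \<and> indep Y}" using indep_empty by simp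
  ultimately have "rank indep A \<in> card ` {Y. Y \<subseteq> A \<and> indep Y}"
    unfolding rank_def by (intro Max_in) auto
  then show ?thesis by auto
qed

lemma extend_to_rank:
  assumes "A \<subseteq> S" "Y \<subseteq> A" "indep Y"
  shows "\<exists>B. Y \<subseteq> B \<and> B \<subseteq> A \<and> indep B \<and> card B = rank indep A"
  using assms(2,3)
proof (induction "rank indep A - card Y" arbitrary: Y)
  case 0
  then have "card Y = rank indep A" using card_le_rank[OF assms(1) 0(2,3)] by linarith
  then show ?case using 0(2,3) by (intro exI[of _ Y]) simp
next
  case (Suc n)
  obtain Z where Z: "Z \<subseteq> A" "indep Z" "card Z = rank indep A"
    using rank_attained[OF assms(1)] by auto
  have "card Y < card Z" using Suc.hyps(2) Z(3) by linarith
  then obtain x where x: "x \<in> Z - Y" "indep (insert x Y)"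
    using indep_augment[OF Suc.prems(2) Z(2)] by auto
  have "card (insert x Y) = Suc (card Y)"
    using x finite_indep[OF Suc.prems(2)] by simp
  then have n: "n = rank indep A - card (insert x Y)" using Suc.hyps(2) by linarith
  have "insert x Y \<subseteq> A" using x(1) Z(1) Suc.prems(1) by auto
  then obtain B where "insert x Y \<subseteq> B" "B \<subseteq> A" "indep B" "card B = rank indep A"
    using Suc.hyps(1)[OF n _ x(2)] by auto
  then show ?case by (intro exI[of _ B]) simp
qed

lemma rank_mono:
  assumes "A \<subseteq> B" "B \<subseteq> S"
  shows "rank indep A \<le> rank indep B"
proof -
  obtain Y where "Y \<subseteq> A" "indep Y" "card Y = rank indep A"
    using rank_attained[OF subset_trans[OF assms]] by auto
  then show ?thesis using card_le_rank[OF assms(2), of Y] assms(1) by auto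
qed

lemma rank_le_card:
  assumes "A \<subseteq> S"
  shows "rank indep A \<le> card A"
proof -
  obtain Y where "Y \<subseteq> A" "card Y = rank indep A" using rank_attained[OF assms] by auto
  then show ?thesis using card_mono[OF finite_sub[OF assms]] by metis
qed

lemma rank_empty: "rank indep {} = 0"
  using rank_le_card[of "{}"] by simp

lemma indep_iff_rank:
  assumes "A \<subseteq> S"
  shows "indep A \<longleftrightarrow> rank indep A = card A"
proof
  assume "indep A"
  then show "rank indep A = card A"
    using card_le_rank[OF assms order_refl] rank_le_card[OF assms] by simp
next
  assume "rank indep A = card A"
  moreover obtain Y where "Y \<subseteq> A" "indep Y" "card Y = rank indep A"
    using rank_attained[OF assms] by auto
  ultimately show "indep A" using card_subset_eq[OF finite_sub[OF assms]] by metis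
qed

text \<open>A maximal independent \<open>Z\<close> in \<open>A \<inter> B\<close> extends to a
  maximal independent \<open>Y\<close> in \<open>A \<union> B\<close>; the traces of
  \<open>Y\<close> on \<open>A\<close> and \<open>B\<close> are independent, and inclusion-exclusion
  counts them.\<close>

lemma rank_submodular:
  assumes "A \<subseteq> S" "B \<subseteq> S"
  shows "rank indep (A \<union> B) + rank indep (A \<inter> B) \<le> rank indep A + rank indep B"
proof -
  obtain Z where Z: "Z \<subseteq> A \<inter> B" "indep Z" "card Z = rank indep (A \<inter> B)"
    using rank_attained[of "A \<inter> B"] assms(1) by auto
  obtain Y where Y: "Z \<subseteq> Y" "Y \<subseteq> A \<union> B" "indep Y" "card Y = rank indep (A \<union> B)"
    using extend_to_rank[of "A \<union> B" Z] Z(1,2) assms by auto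
  have fY: "finite Y" using Y(3) finite_indep by blast
  have "card (Y \<inter> A) \<le> rank indep A" "card (Y \<inter> B) \<le> rank indep B"
    using assms Y(3) indep_subset by (auto intro!: card_le_rank)
  moreover have "card Y + card (Y \<inter> (A \<inter> B)) = card (Y \<inter> A) + card (Y \<inter> B)"
  proof -
    have "Y \<inter> A \<union> Y \<inter> B = Y" "(Y \<inter> A) \<inter> (Y \<inter> B) = Y \<inter> (A \<inter> B)" using Y(2) by auto
    then show ?thesis using card_Un_Int[of "Y \<inter> A" "Y \<inter> B"] fY by simp
  qed
  moreover have "card Z \<le> card (Y \<inter> (A \<inter> B))"
    using Z(1) Y(1) fY by (intro card_mono) auto
  ultimately show ?thesis using Z(3) Y(4) by linarith
qed

lemma rank_Un_le:
  assumes "A \<subseteq> S" "B \<subseteq> S"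
  shows "rank indep (A \<union> B) \<le> rank indep A + rank indep B"
  using rank_submodular[OF assms] by linarith

lemma rank_remove:
  assumes "A \<subseteq> S" "x \<in> A"
  shows "rank indep A \<le> rank indep (A - {x}) + 1"
proof -
  have "rank indep {x} \<le> 1" using rank_le_card[of "{x}"] assms by auto
  moreover have "A - {x} \<union> {x} = A" using assms by auto
  ultimately show ?thesis using rank_Un_le[of "A - {x}" "{x}"] assms by fastforce
qed

text \<open>Submodularity for \<open>A\<close> and \<open>B - {x}\<close>: an element spanned by the
  rest of \<open>A\<close> is spanned by the rest of any larger set.\<close>

lemma rank_remove_mono:
  assumes "B \<subseteq> S" "A \<subseteq> B" "x \<in> A" "rank indep (A - {x}) = rank indep A"
  shows "rank indep (B - {x}) = rank indep B"
proof -
  have "A \<union> (B - {x}) = B" "A \<inter> (B - {x}) = A - {x}" using assms by auto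
  then have "rank indep B \<le> rank indep (B - {x})"
    using rank_submodular[of A "B - {x}"] assms by auto
  then show ?thesis using rank_mono[of "B - {x}" B] assms by auto
qed

section \<open>The dual matroid and T-flats\<close>

lemma basis_iff:
  "matroid_basis S indep B \<longleftrightarrow> indep B \<and> card B = rank indep S"
proof
  assume B: "matroid_basis S indep B"
  then have i: "indep B" by (simp add: matroid_basis_def)
  then obtain C where "B \<subseteq> C" "C \<subseteq> S" "indep C" "card C = rank indep S"
    using extend_to_rank[OF order_refl indep_subset_ground[OF i] i] by auto
  then show "indep B \<and> card B = rank indep S"
    using B unfolding matroid_basis_def by auto
next
  assume B: "indep B \<and> card B = rank indep S"
  show "matroid_basis S indep B"
    unfolding matroid_basis_def
  proof (intro conjI allI impI)
    fix Y assume Y: "Y \<subseteq> S" "indep Y" "B \<subseteq> Y"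
    then have "card Y \<le> card B" using B card_le_rank[of S Y] by simp
    then show "Y = B" using Y finite_sub by (metis card_seteq)
  qed (use B in simp)
qed

text \<open>The dual rank of \<open>Z\<close> is |Z| - r(S) + r(S - Z), written here without
  subtraction. It is attained at \<open>Z - B\<close>, where the basis \<open>B\<close> has the
  largest possible trace on \<open>S - Z\<close>.\<close>

lemma dual_rank:
  assumes "Z \<subseteq> S"
  shows "rank (dual_indep S indep) Z + rank indep S = card Z + rank indep (S - Z)"
proof -
  have fX: "finite Z" using assms finite_sub by blast
  let ?F = "{Y. Y \<subseteq> Z \<and> dual_indep S indep Y}"
  obtain C where C: "C \<subseteq> S - Z" "indep C" "card C = rank indep (S - Z)"
    using rank_attained[of "S - Z"] by auto
  obtain B where B: "C \<subseteq> B" "B \<subseteq> S" "indep B" "card B = rank indep S"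
    using extend_to_rank[of S C] C by auto
  have cardB: "card B' = card (B' \<inter> Z) + card (B' - Z)" if "B' \<subseteq> S" for B'
    using card_Int_Diff[of B' Z] that finite_sub by auto
  have cX: "card Z = card (Z - B') + card (B' \<inter> Z)" for B'
    using card_Int_Diff[OF fX, of B'] by (simp add: Int_commute)
  have le: "card (B' - Z) \<le> rank indep (S - Z)" if "indep B'" for B'
    using that indep_subset_ground indep_subset by (intro card_le_rank) auto
  have "C \<subseteq> B - Z" using B C by auto
  then have "card C \<le> card (B - Z)" using finite_indep[OF B(3)] by (intro card_mono) auto
  \<comment> \<open>Since \<open>B\<close> extends \<open>C\<close>, the set \<open>B - Z\<close>
    has exactly \<open>rank indep (S - Z)\<close> elements.\<close>
  then have 1: "card (Z - B) + rank indep S = card Z + rank indep (S - Z)"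
    using le[OF B(3)] C(3) cX[of B] cardB[OF B(2)] B(4) by linarith
  have "rank (dual_indep S indep) Z = card (Z - B)"
    unfolding rank_def
  proof (rule Max_eqI)
    show "finite (card ` ?F)" using fX by simp
    have "Z - B \<in> ?F" unfolding dual_indep_def basis_iff using B assms by auto
    then show "card (Z - B) \<in> card ` ?F" by blast
    fix y assume "y \<in> card ` ?F"
    then obtain Y B' where Y: "y = card Y" "Y \<subseteq> Z" "indep B'" "card B' = rank indep S" "Y \<subseteq> S - B'"
      unfolding dual_indep_def basis_iff by auto
    have "card Y \<le> card (Z - B')" using Y fX by (intro card_mono) auto
    then show "y \<le> card (Z - B)"
      using 1 cX[of B'] le[OF Y(3)] Y cardB[of B'] indep_subset_ground[OF Y(3)] by linarith
  qed
  then show ?thesis using 1 by simp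
qed

text \<open>By the dual rank formula, adding \<open>x\<close> to \<open>S - A\<close> raises the
  dual rank exactly when deleting \<open>x\<close> from \<open>A\<close> keeps the rank of
  \<open>A\<close>, that is, when \<open>x\<close> lies on a circuit inside \<open>A\<close>.
  Properness of the flat becomes \<open>A \<noteq> {}\<close>.\<close>

lemma T_flat_iff:
  "T_flat S indep A \<longleftrightarrow> A \<subseteq> S \<and> A \<noteq> {} \<and> (\<forall>x\<in>A. rank indep (A - {x}) = rank indep A)"
proof (cases "A \<subseteq> S")
  case True
  have "rank (dual_indep S indep) (S - A) < rank (dual_indep S indep) (insert x (S - A))
      \<longleftrightarrow> rank indep (A - {x}) = rank indep A" if "x \<in> A" for x
  proof -
    have "S - (S - A) = A" "S - insert x (S - A) = A - {x}" using True by auto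
    moreover have "card (insert x (S - A)) = card (S - A) + 1"
      using that finite_ground by simp
    moreover have "insert x (S - A) \<subseteq> S" using True that by auto
    ultimately show ?thesis
      using dual_rank[of "S - A"] dual_rank[of "insert x (S - A)"]
        rank_remove[OF True that] rank_mono[OF Diff_subset True, of "{x}"]
      by (simp del: card_insert_disjoint) linarith
  qed
  moreover have "S - (S - A) = A" using True by auto
  moreover have "S - A \<noteq> S \<longleftrightarrow> A \<noteq> {}" using True by auto
  ultimately show ?thesis using True unfolding T_flat_def flat_def by auto
qed (auto simp: T_flat_def)

text \<open>Nullity is the level plus one and so stays in the natural numbers; on subsets of
  \<open>S\<close> the subtraction does not truncate, by \<open>rank_le_card\<close>.\<close>

abbreviation nullity :: "'a set \<Rightarrow> nat" where
  "nullity A \<equiv> card A - rank indep A"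

lemma nullity_mono:
  assumes "A \<subseteq> B" "B \<subseteq> S"
  shows "nullity A \<le> nullity B"
proof -
  have "A \<union> (B - A) = B" using assms by auto
  then have "rank indep B \<le> rank indep A + card (B - A)"
    using rank_Un_le[of A "B - A"] rank_le_card[of "B - A"] subset_trans[OF Diff_subset assms(2)]
      subset_trans[OF assms] by simp
  moreover have "card (B - A) + card A = card B"
    using card_Int_Diff[OF finite_sub[OF assms(2)], of A] assms(1) by (simp add: Int_absorb1)
  ultimately show ?thesis by linarith
qed

lemma T_flats_iff:
  "A \<in> T_flats S indep n \<longleftrightarrow> T_flat S indep A \<and> nullity A = Suc n"
proof (cases "A \<subseteq> S")
  case True
  then show ?thesis using rank_le_card[OF True] by (auto simp: T_flats_def level_def)
qed (auto simp: T_flats_def T_flat_def)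

lemma T_flat_nullity:
  assumes "T_flat S indep A"
  shows "0 < nullity A"
proof -
  obtain x where x: "x \<in> A" "A \<subseteq> S" "rank indep (A - {x}) = rank indep A"
    using assms T_flat_iff by auto
  then have "card (A - {x}) < card A"
    using finite_sub by (meson card_Diff1_less)
  moreover have "rank indep (A - {x}) \<le> card (A - {x})" using x by (intro rank_le_card) auto
  ultimately show ?thesis using x(3) by linarith
qed

text \<open>Submodularity is used twice, with \<open>A \<union> D\<close> as the intermediate set
  between \<open>A \<union> B\<close> and \<open>C \<union> D\<close>.\<close>

lemma rank_separation_subset:
  assumes "A \<union> B \<subseteq> S" "A \<inter> B = {}" "rank indep (A \<union> B) = rank indep A + rank indep B"
    "C \<subseteq> A" "D \<subseteq> B"
  shows "rank indep (C \<union> D) = rank indep C + rank indep D"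
proof -
  have sub: "A \<subseteq> S" "B \<subseteq> S" "C \<subseteq> S" "D \<subseteq> S" using assms by auto
  have "A \<union> (C \<union> D) = A \<union> D" "A \<inter> (C \<union> D) = C" "(A \<union> D) \<union> B = A \<union> B" "(A \<union> D) \<inter> B = D"
    using assms by auto
  then have "rank indep (A \<union> D) + rank indep C \<le> rank indep A + rank indep (C \<union> D)"
    "rank indep (A \<union> B) + rank indep D \<le> rank indep (A \<union> D) + rank indep B"
    using rank_submodular[of A "C \<union> D"] rank_submodular[of "A \<union> D" B] sub by auto
  then show ?thesis using rank_Un_le[OF sub(3,4)] assms(3) by linarith
qed

text \<open>Deleting \<open>x\<close> from \<open>B\<close> keeps the rank of \<open>K\<close>, and
  since ranks add up over the separation, the rank of \<open>B\<close> cannot drop. A nonempty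
  \<open>A\<close> is covered by swapping the parts.\<close>

lemma T_flat_separation:
  assumes "T_flat S indep K" "A \<union> B = K" "A \<inter> B = {}" "B \<noteq> {}"
    "rank indep K = rank indep A + rank indep B"
  shows "T_flat S indep B"
  unfolding T_flat_iff
proof (intro conjI ballI)
  show B: "B \<subseteq> S" using assms T_flat_iff by auto
  show "B \<noteq> {}" by fact
  fix x assume x: "x \<in> B"
  have K: "K \<subseteq> S" using assms T_flat_iff by auto
  have "rank indep (K - {x}) = rank indep K" using x assms(1,2) T_flat_iff by blast
  moreover have "K - {x} = A \<union> (B - {x})" using x assms by auto
  ultimately have "rank indep K \<le> rank indep A + rank indep (B - {x})"
    using rank_Un_le[of A "B - {x}"] K assms(2) by fastforce
  then show "rank indep (B - {x}) = rank indep B"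
    using assms(5) rank_mono[of "B - {x}" B] B by auto
qed

lemma nullity_separation:
  assumes "K \<subseteq> S" "A \<union> B = K" "A \<inter> B = {}" "rank indep K = rank indep A + rank indep B"
  shows "nullity K = nullity A + nullity B"
proof -
  have "card K = card A + card B"
    using assms finite_sub[of A] finite_sub[of B] card_Un_disjoint[of A B] by auto
  then show ?thesis using assms rank_le_card[of A] rank_le_card[of B] by auto
qed

section \<open>Ear decompositions\<close>

text \<open>Both parts of a separation would be T-flats, each of nullity at least 1, while level 0
  means total nullity 1.\<close>

lemma connected_T_flats_0:
  assumes "C \<in> T_flats S indep 0"
  shows "connected_in indep C"
proof (rule ccontr)
  assume "\<not> connected_in indep C"
  then obtain A B where AB: "A \<noteq> {}" "B \<noteq> {}" "A \<inter> B = {}" "A \<union> B = C"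
      "rank indep C = rank indep A + rank indep B"
    unfolding connected_in_def by blast
  have C: "T_flat S indep C" "nullity C = 1" using assms T_flats_iff by auto
  have "T_flat S indep B"
    using T_flat_separation[OF C(1) AB(4,3,2,5)] .
  moreover have "T_flat S indep A"
    by (rule T_flat_separation[OF C(1), of B]) (use AB in auto)
  moreover have "C \<subseteq> S" using C(1) T_flat_iff by simp
  ultimately show False
    using nullity_separation[OF _ AB(4,3,5)] C(2) T_flat_nullity[of A] T_flat_nullity[of B]
    by linarith
qed

text \<open>A connected \<open>J\<close> lies in one part of any separation of \<open>K\<close>. The
  other part has nullity at least 1, so the part containing \<open>J\<close> has no more nullity
  than \<open>J\<close>; being a T-flat, it equals \<open>J\<close>, against the rank inequality
  \<open>r\<close>.\<close>

lemma connected_in_step: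
  assumes J: "J \<in> T_flats S indep n" "connected_in indep J"
    and K: "K \<in> T_flats S indep (Suc n)" and JK: "J \<subset> K"
    and r: "rank indep K < rank indep (K - J) + rank indep J"
  shows "connected_in indep K"
proof (rule ccontr)
  have KS: "K \<subseteq> S" and TK: "T_flat S indep K" using K by (auto simp: T_flats_iff T_flat_iff)
  have no: False if AB: "B \<noteq> {}" "A \<inter> B = {}" "A \<union> B = K"
      "rank indep K = rank indep A + rank indep B" "J \<subseteq> A" for A B
  proof -
    have "T_flat S indep B" using T_flat_separation[OF TK AB(3,2,1,4)] .
    moreover have "nullity K = Suc (Suc n)" using K T_flats_iff by simp
    ultimately have "nullity A \<le> Suc n"
      using T_flat_nullity[of B] nullity_separation[OF KS AB(3,2,4)] by linarith
    have "A \<noteq> J"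
    proof
      assume "A = J"
      then have "K - J = B" using AB(2,3) by auto
      then show False using r AB(4) \<open>A = J\<close> by simp
    qed
    then obtain x where x: "x \<in> A" "x \<notin> J" using AB by blast
    have AS: "A \<subseteq> S" using AB KS by auto
    have "A \<noteq> {}" using x by auto
    then have "T_flat S indep A"
      by (intro T_flat_separation[OF TK, of B]) (use AB in auto)
    then have "rank indep (A - {x}) = rank indep A" using x T_flat_iff by blast
    moreover have "card (A - {x}) < card A" using x AS finite_sub by (meson card_Diff1_less)
    moreover have "nullity J \<le> nullity (A - {x})" using AB(5) AS x(2) by (intro nullity_mono) auto
    moreover have "nullity J = Suc n" using J(1) T_flats_iff by simp
    moreover have "rank indep (A - {x}) \<le> card (A - {x})" using AS by (intro rank_le_card) auto
    ultimately show False using \<open>nullity A \<le> Suc n\<close> by linarith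
  qed
  assume "\<not> connected_in indep K"
  then obtain A B where AB: "A \<noteq> {}" "B \<noteq> {}" "A \<inter> B = {}" "A \<union> B = K"
      "rank indep K = rank indep A + rank indep B"
    unfolding connected_in_def by blast
  \<comment> \<open>The separation of \<open>K\<close> restricts to \<open>J\<close> by
    \<open>rank_separation_subset\<close>, so connectedness makes one trace of \<open>J\<close>
    empty.\<close>
  have "J = (J \<inter> A) \<union> (J \<inter> B)" using AB JK by auto
  moreover have "rank indep (J \<inter> A \<union> J \<inter> B) = rank indep (J \<inter> A) + rank indep (J \<inter> B)"
    by (rule rank_separation_subset[of A B]) (use AB KS in auto)
  moreover have "J \<inter> A \<inter> (J \<inter> B) = {}" using AB(3) by auto
  ultimately have "J \<inter> A = {} \<or> J \<inter> B = {}"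
    using J(2) unfolding connected_in_def by metis
  then have "J \<subseteq> A \<or> J \<subseteq> B" using AB JK by blast
  then show False
  proof
    assume "J \<subseteq> B"
    then show False by (intro no[of A B]) (use AB in auto)
  qed (use no[OF AB(2,3,4,5)] in simp)
qed

text \<open>A dependent subset of \<open>I\<close> of least size works: deleting any element leaves
  an independent set, so the rank is \<open>card C - 1\<close> with or without that element.\<close>

lemma T_flat_contains_circuit:
  assumes "T_flat S indep I"
  obtains C where "C \<subseteq> I" "C \<in> T_flats S indep 0"
proof -
  have IS: "I \<subseteq> S" using assms T_flat_iff by auto
  define P where "P = (\<lambda>C. C \<subseteq> I \<and> \<not> indep C)"
  have "P I" unfolding P_def using indep_iff_rank[OF IS] T_flat_nullity[OF assms] by simp
  then obtain C where C: "P C" and min: "\<And>D. card D < card C \<Longrightarrow> \<not> P D"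
    using exists_least_iff[of "\<lambda>n. \<exists>C. P C \<and> card C = n"] by blast
  have CS: "C \<subseteq> S" "C \<subseteq> I" "\<not> indep C" using C IS by (auto simp: P_def)
  have r: "rank indep (C - {x}) = card C - 1" "0 < card C" if "x \<in> C" for x
  proof -
    have fin: "finite C" using CS finite_sub by auto
    then have "card (C - {x}) < card C" using that by (meson card_Diff1_less)
    then have "indep (C - {x})" using min[of "C - {x}"] CS unfolding P_def by auto
    then show "rank indep (C - {x}) = card C - 1" "0 < card C"
      using indep_iff_rank[of "C - {x}"] CS that fin card_gt_0_iff by auto
  qed
  have rC: "rank indep C < card C" using CS indep_iff_rank[of C] rank_le_card[of C] by auto
  have ne: "C \<noteq> {}" using CS indep_empty by auto
  then obtain c where c: "c \<in> C" by auto
  have eq: "rank indep C = card C - 1"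
    using r[OF c] rC rank_mono[OF Diff_subset CS(1), of "{c}"] by linarith
  have "nullity C = 1" using eq r(2)[OF c] by linarith
  then have "C \<in> T_flats S indep 0"
    unfolding T_flats_iff T_flat_iff using CS(1) ne r(1) eq by simp
  then show ?thesis using that CS by blast
qed

text \<open>A minimal \<open>D \<subseteq> I - J\<close> that is not separated from \<open>J\<close> is independent, and \<open>J \<union> D\<close> is the
  required extension.\<close>
lemma ear_exists:
  assumes I: "I \<subseteq> S" "connected_in indep I" and J: "J \<in> T_flats S indep n" "J \<subset> I"
  obtains K where "J \<subset> K" "K \<subseteq> I" "K \<in> T_flats S indep (Suc n)"
    "rank indep K < rank indep (K - J) + rank indep J"
proof -
  define P where "P = (\<lambda>D. D \<subseteq> I - J \<and> rank indep (J \<union> D) < rank indep D + rank indep J)"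
  have TJ: "T_flat S indep J" "J \<noteq> {}" "nullity J = Suc n" "J \<subseteq> S"
    using J by (auto simp: T_flats_iff T_flat_iff)
  have "J \<union> (I - J) = I" using J by auto
  moreover have "I - J \<noteq> {}" "J \<inter> (I - J) = {}" using J(2) by auto
  ultimately have "rank indep (J \<union> (I - J)) \<noteq> rank indep J + rank indep (I - J)"
    using I(2) TJ(2) unfolding connected_in_def by metis
  then have "P (I - J)"
    unfolding P_def using rank_Un_le[OF TJ(4) subset_trans[OF Diff_subset I(1)], of J]
    by (intro conjI) (simp_all del: Un_Diff_cancel)
  then obtain D where PD: "P D" and min: "\<And>E. card E < card D \<Longrightarrow> \<not> P E"
    using exists_least_iff[of "\<lambda>n. \<exists>C. P C \<and> card C = n"] by blast
  have D: "D \<subseteq> I - J" "rank indep (J \<union> D) < rank indep D + rank indep J" "D \<subseteq> S"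
    using PD I by (auto simp: P_def)
  have fD: "finite D" using D finite_sub by blast
  have "D \<noteq> {}" using D(2) rank_empty by auto
  \<comment> \<open>In r(D - x) + r(J) \<le> r(J \<union> D - x) \<le> r(J \<union> D) < r(D) +
    r(J), where minimality gives the first step, the outer terms differ by at most 1. So every \<le>
    is an equality and the strict step is a gap of exactly 1.\<close>
  have rem: "rank indep (J \<union> D - {x}) = rank indep (J \<union> D) \<and> rank indep (D - {x}) + 1 = rank indep D
       \<and> rank indep (J \<union> D) + 1 = rank indep J + rank indep D"
    if x: "x \<in> D" for x
  proof -
    have "card (D - {x}) < card D" using fD x by (meson card_Diff1_less)
    then have "\<not> P (D - {x})" using min by blast
    moreover have "J \<union> (D - {x}) = J \<union> D - {x}" using x D by auto
    ultimately have "rank indep (D - {x}) + rank indep J \<le> rank indep (J \<union> D - {x})"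
      unfolding P_def using D(1) by auto
    moreover have "rank indep (J \<union> D - {x}) \<le> rank indep (J \<union> D)"
      using rank_mono[of "J \<union> D - {x}" "J \<union> D"] TJ(4) D(3) by auto
    ultimately show ?thesis using rank_remove[OF D(3) x] D(2) by linarith
  qed
  \<comment> \<open>Deleting any element lowers the rank of \<open>D\<close>, so a maximal
    independent subset misses none.\<close>
  have "indep D"
  proof -
    obtain Y where Y: "Y \<subseteq> D" "indep Y" "card Y = rank indep D" using rank_attained[OF D(3)] by auto
    have "x \<in> Y" if "x \<in> D" for x
    proof (rule ccontr)
      assume "x \<notin> Y"
      then have "card Y \<le> rank indep (D - {x})" using Y D(3) by (intro card_le_rank) auto
      then show False using rem[OF that] Y(3) by auto
    qed
    then show ?thesis using Y by (metis subsetI subset_antisym)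
  qed
  then have cD: "rank indep D = card D" using indep_iff_rank[OF D(3)] by simp
  have c: "card (J \<union> D) = card J + card D"
    using D TJ finite_sub by (intro card_Un_disjoint) auto
  obtain d where d: "d \<in> D" using \<open>D \<noteq> {}\<close> by auto
  have "rank indep (J \<union> D - {x}) = rank indep (J \<union> D)" if "x \<in> J \<union> D" for x
  proof (cases "x \<in> D")
    case False
    then show ?thesis
      using rank_remove_mono[of "J \<union> D" J x] that TJ D(3) T_flat_iff[of J] by auto
  qed (use rem in auto)
  then have "T_flat S indep (J \<union> D)" unfolding T_flat_iff using TJ D(3) by auto
  \<comment> \<open>\<open>D\<close> adds \<open>card D\<close> elements but only
    \<open>card D - 1\<close> to the rank.\<close>
  moreover have "nullity (J \<union> D) = Suc (Suc n)"
    using c cD rem[OF d] TJ(3) rank_le_card[OF TJ(4)] by linarith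
  moreover have "J \<union> D - J = D" using D(1) by auto
  ultimately show ?thesis
    using that[of "J \<union> D"] D J(2) d by (auto simp: T_flats_iff)
qed

text \<open>The inequality at \<open>i\<close> is the rank form of the \<open>i\<close>-th factor of
  \<open>chain_space\<close> being nonzero; a chain with one member satisfies the condition
  vacuously.\<close>

definition ear_chain :: "'a set list \<Rightarrow> bool" where
  "ear_chain Is \<longleftrightarrow>
     (\<forall>i\<in>{1..<length Is}. rank indep (Is ! i) < rank indep (Is ! i - Is ! (i - 1)) + rank indep (Is ! (i - 1)))"

text \<open>The level of \<open>I\<close> disappears as a separate condition: the last member lies
  in \<open>T_flats\<close> at its own index, which fixes the level.\<close>

lemma chains_iff:
  "Is \<in> chains S indep I \<longleftrightarrow> Is \<noteq> [] \<and> last Is = I \<and>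
     (\<forall>i<length Is. Is ! i \<in> T_flats S indep i) \<and> (\<forall>i. Suc i < length Is \<longrightarrow> Is ! i \<subset> Is ! Suc i)"
proof (cases Is rule: rev_cases)
  case (snoc Js J)
  have "level indep J = int (length Js)" if "(Js @ [J]) ! length Js \<in> T_flats S indep (length Js)"
    using that by (simp add: T_flats_def)
  then show ?thesis
    unfolding chains_def snoc
    by (simp add: less_Suc_eq_le Suc_le_eq) (metis nth_append_length order_refl)
qed (simp add: chains_def)

lemma chain_connected:
  assumes "Is \<in> chains S indep I" "ear_chain Is" "i < length Is"
  shows "connected_in indep (Is ! i)"
  using assms(3)
proof (induction i)
  have mem: "Is ! j \<in> T_flats S indep j" if "j < length Is" for j
    using assms(1)[unfolded chains_iff] that by blast
  {
    case 0
    show ?case by (rule connected_T_flats_0[OF mem[OF 0]])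
  next
    case (Suc i)
    have "rank indep (Is ! Suc i) < rank indep (Is ! Suc i - Is ! i) + rank indep (Is ! i)"
      using assms(2)[unfolded ear_chain_def, rule_format, of "Suc i"] Suc.prems by simp
    moreover have "Is ! i \<subset> Is ! Suc i"
      using assms(1)[unfolded chains_iff] Suc.prems by blast
    ultimately show ?case
      by (intro connected_in_step[OF mem Suc.IH mem[OF Suc.prems]])
        (use Suc.prems in simp_all)
  }
qed

lemma ear_chain_extend:
  assumes Is: "Is \<in> chains S indep J" "ear_chain Is"
    and J: "J \<in> T_flats S indep n"
    and K: "K \<in> T_flats S indep (Suc n)" "J \<subset> K"
      "rank indep K < rank indep (K - J) + rank indep J"
  shows "Is @ [K] \<in> chains S indep K" "ear_chain (Is @ [K])"
proof -
  have "Is \<noteq> []" and J_last: "last Is = J"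
    and mem: "\<And>i. i < length Is \<Longrightarrow> Is ! i \<in> T_flats S indep i"
    and inc: "\<And>i. Suc i < length Is \<Longrightarrow> Is ! i \<subset> Is ! Suc i"
    using Is(1) by (simp_all add: chains_iff)
  then obtain m where m: "length Is = Suc m" by (cases Is) simp_all
  then have Jm: "Is ! m = J" using J_last last_conv_nth[OF \<open>Is \<noteq> []\<close>] by simp
  then have "J \<in> T_flats S indep m" using mem[of m] m by simp
  \<comment> \<open>The index of the last member is its level.\<close>
  then have "n = m" using J by (simp add: T_flats_def)
  then show "Is @ [K] \<in> chains S indep K"
    unfolding chains_iff
  proof (intro conjI allI impI)
    fix i assume "i < length (Is @ [K])"
    then consider "i < Suc m" | "i = Suc m" using m by fastforce
    then show "(Is @ [K]) ! i \<in> T_flats S indep i"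
      using mem m K(1) \<open>n = m\<close> by cases (simp_all add: nth_append)
  next
    fix i assume "Suc i < length (Is @ [K])"
    then consider "Suc i < Suc m" | "i = m" using m by fastforce
    then show "(Is @ [K]) ! i \<subset> (Is @ [K]) ! Suc i"
      using inc m K(2) Jm by cases (simp_all add: nth_append)
  qed simp_all
  show "ear_chain (Is @ [K])"
    unfolding ear_chain_def
  proof
    fix i assume "i \<in> {1..<length (Is @ [K])}"
    then consider "i \<in> {1..<length Is}" | "i = Suc m" using m by fastforce
    then show "rank indep ((Is @ [K]) ! i)
        < rank indep ((Is @ [K]) ! i - (Is @ [K]) ! (i - 1)) + rank indep ((Is @ [K]) ! (i - 1))"
    proof cases
      case 1
      then have "i - 1 < length Is" "i < length Is" by auto
      then show ?thesis using Is(2) 1 by (simp add: ear_chain_def nth_append)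
    qed (use m K(3) Jm in \<open>simp add: nth_append\<close>)
  qed
qed

text \<open>A circuit in \<open>I\<close> starts the chain, and \<open>ear_exists\<close> extends it
  as long as its last member \<open>J\<close> is not \<open>I\<close>; \<open>I - J\<close> shrinks
  with each step.\<close>

lemma ear_chain_exists:
  assumes I: "T_flat S indep I" "connected_in indep I"
  shows "\<exists>Is\<in>chains S indep I. ear_chain Is"
proof -
  have IS: "I \<subseteq> S" using I T_flat_iff by auto
  have "\<exists>Is\<in>chains S indep I. ear_chain Is"
    if "J \<subseteq> I" "Js \<in> chains S indep J" "ear_chain Js" for J Js
    using that
  proof (induction "card (I - J)" arbitrary: J Js rule: less_induct)
    case less
    show ?case
    proof (cases "J = I")
      case False
      obtain n where n: "J \<in> T_flats S indep n"
        using less.prems(2) unfolding chains_def mem_Collect_eq by (metis order_refl)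
      obtain K where K: "J \<subset> K" "K \<subseteq> I" "K \<in> T_flats S indep (Suc n)"
        "rank indep K < rank indep (K - J) + rank indep J"
        by (rule ear_exists[OF IS I(2) n psubsetI[OF less.prems(1) False]])
      have "card (I - K) < card (I - J)"
        using K(1,2) finite_sub[OF IS] by (intro psubset_card_mono) auto
      then show ?thesis
        using less.hyps[OF _ K(2) ear_chain_extend[OF less.prems(2,3) n K(3,1,4)]] by simp
    qed (use less.prems(2,3) in auto)
  qed
  moreover obtain C where C: "C \<subseteq> I" "C \<in> T_flats S indep 0"
    by (rule T_flat_contains_circuit[OF I(1)])
  moreover have "[C] \<in> chains S indep C" "ear_chain [C]"
    using C(2) by (simp_all add: chains_iff ear_chain_def)
  ultimately show ?thesis by metis
qed

lemma connected_iff_ear_chain: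
  assumes "T_flat S indep I"
  shows "connected_in indep I \<longleftrightarrow> (\<exists>Is\<in>chains S indep I. ear_chain Is)"
proof
  assume "\<exists>Is\<in>chains S indep I. ear_chain Is"
  then obtain Is where Is: "Is \<in> chains S indep I" "ear_chain Is" by auto
  have ne: "Is \<noteq> []" and "last Is = I" using Is(1) by (simp_all add: chains_iff)
  then show "connected_in indep I"
    using chain_connected[OF Is, of "length Is - 1"] last_conv_nth[OF ne] by simp
qed (rule ear_chain_exists[OF assms])

end

section \<open>Products of vectors in the symmetric algebra\<close>

lemma poly_mapping_sum_single: "p = (\<Sum>m\<in>Poly_Mapping.keys p. Poly_Mapping.single m (Poly_Mapping.lookup p m))"
  by (rule poly_mapping_eqI)
    (auto simp: lookup_sum lookup_single when_def sum.delta' in_keys_iff)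

definition monom_eval :: "('w \<Rightarrow> 'r::comm_ring_1) \<Rightarrow> ('w \<Rightarrow>\<^sub>0 nat) \<Rightarrow> 'r" where
  "monom_eval f m = (\<Prod>w\<in>Poly_Mapping.keys m. f w ^ Poly_Mapping.lookup m w)"

text \<open>The substitution homomorphism that sends the variable of \<open>w\<close> to
  \<open>f w\<close>. The target \<open>'k poly\<close> is a domain of infinite dimension, so that
  linear maps injective on a given finite-dimensional subspace exist over every field, finite ones
  included.\<close>

definition poly_eval :: "('w \<Rightarrow> 'k::field poly) \<Rightarrow> ('w, 'k) vec_poly \<Rightarrow> 'k poly" where
  "poly_eval f p = (\<Sum>m\<in>Poly_Mapping.keys p. smult (Poly_Mapping.lookup p m) (monom_eval f m))"

lemma monom_eval_superset:
  assumes "finite A" "Poly_Mapping.keys m \<subseteq> A"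
  shows "monom_eval f m = (\<Prod>w\<in>A. f w ^ Poly_Mapping.lookup m w)"
  unfolding monom_eval_def using assms by (intro prod.mono_neutral_left) (auto simp: in_keys_iff)

lemma poly_eval_superset:
  assumes "finite A" "Poly_Mapping.keys p \<subseteq> A"
  shows "poly_eval f p = (\<Sum>m\<in>A. smult (Poly_Mapping.lookup p m) (monom_eval f m))"
  unfolding poly_eval_def using assms by (intro sum.mono_neutral_left) (auto simp: in_keys_iff)

lemma monom_eval_add: "monom_eval f (m + n) = monom_eval f m * monom_eval f n"
proof -
  let ?A = "Poly_Mapping.keys m \<union> Poly_Mapping.keys n"
  have "Poly_Mapping.keys (m + n) \<subseteq> ?A" by (rule Poly_Mapping.keys_add)
  then show ?thesis
    by (simp add: monom_eval_superset[of ?A] lookup_add power_add prod.distrib)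
qed

lemma monom_eval_0 [simp]: "monom_eval f 0 = 1"
  by (simp add: monom_eval_def)

lemma poly_eval_add: "poly_eval f (p + q) = poly_eval f p + poly_eval f q"
proof -
  let ?A = "Poly_Mapping.keys p \<union> Poly_Mapping.keys q"
  have "Poly_Mapping.keys (p + q) \<subseteq> ?A" by (rule Poly_Mapping.keys_add)
  then show ?thesis
    by (simp add: poly_eval_superset[of ?A] lookup_add smult_add_left sum.distrib)
qed

lemma poly_eval_0 [simp]: "poly_eval f 0 = 0"
  by (simp add: poly_eval_def)

lemma poly_eval_diff: "poly_eval f (p - q) = poly_eval f p - poly_eval f q"
  using poly_eval_add[of f "p - q" q] by (simp add: algebra_simps)

lemma poly_eval_sum: "poly_eval f (sum g A) = (\<Sum>a\<in>A. poly_eval f (g a))"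
  by (induction A rule: infinite_finite_induct) (auto simp: poly_eval_add)

lemma poly_eval_single: "poly_eval f (Poly_Mapping.single m c) = smult c (monom_eval f m)"
  by (subst poly_eval_superset[of "{m}"]) auto

lemma poly_eval_mult: "poly_eval f (p * q) = poly_eval f p * poly_eval f q"
proof -
  have "p * q = (\<Sum>m\<in>Poly_Mapping.keys p. \<Sum>n\<in>Poly_Mapping.keys q.
      Poly_Mapping.single (m + n) (Poly_Mapping.lookup p m * Poly_Mapping.lookup q n))"
    by (subst (1) poly_mapping_sum_single[of p], subst (1) poly_mapping_sum_single[of q])
      (simp add: sum_product mult_single)
  then show ?thesis
    by (simp add: poly_eval_sum poly_eval_single monom_eval_add)
      (simp add: poly_eval_def sum_product ac_simps)
qed

lemma poly_eval_const: "poly_eval f (poly_const c) = [:c:]"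
  by (simp add: poly_const_def poly_eval_single)

lemma poly_eval_var: "poly_eval f (poly_var w) = f w"
  by (simp add: poly_var_def poly_eval_single monom_eval_def)

lemma poly_eval_1 [simp]: "poly_eval f 1 = 1"
  using poly_eval_const[of f 1] by (simp add: poly_const_def one_pCons)

lemma poly_eval_prod_list: "poly_eval f (prod_list ps) = prod_list (map (poly_eval f) ps)"
  by (induction ps) (auto simp: poly_eval_mult)

section \<open>The symmetric algebra as a quotient ring\<close>

lemma ring_of_type_algebra_simps [simp]:
  "carrier ring_of_type_algebra = UNIV"
  "x \<otimes>\<^bsub>ring_of_type_algebra\<^esub> y = x * y"
  "\<one>\<^bsub>ring_of_type_algebra\<^esub> = 1"
  "\<zero>\<^bsub>ring_of_type_algebra\<^esub> = 0"
  "x \<oplus>\<^bsub>ring_of_type_algebra\<^esub> y = x + y"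
  by (simp_all add: ring_of_type_algebra_def)

lemma sym_ideal_ideal: "ideal (sym_ideal scale) ring_of_type_algebra"
  unfolding sym_ideal_def
  by (rule ring.genideal_ideal) (auto intro: ring_from_type_algebra)

lemma cring_Sym: "cring (Sym scale)"
  unfolding Sym_def by (rule ideal.quotient_is_cring[OF sym_ideal_ideal cring_from_type_algebra])

lemma sym_class_hom: "sym_class scale \<in> ring_hom ring_of_type_algebra (Sym scale)"
  using ideal.rcos_ring_hom[OF sym_ideal_ideal] unfolding sym_class_def[abs_def] Sym_def .

lemma sym_class_simps:
  shows sym_class_closed [simp]: "sym_class scale p \<in> carrier (Sym scale)"
    and sym_class_mult: "sym_class scale (p * q) = sym_class scale p \<otimes>\<^bsub>Sym scale\<^esub> sym_class scale q"
    and sym_class_1: "sym_class scale 1 = \<one>\<^bsub>Sym scale\<^esub>"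
  using ring_hom_closed[OF sym_class_hom, of p] ring_hom_mult[OF sym_class_hom, of p q]
    ring_hom_one[OF sym_class_hom] by simp_all

lemma sym_class_eq_0_iff: "sym_class scale p = \<zero>\<^bsub>Sym scale\<^esub> \<longleftrightarrow> p \<in> sym_ideal scale"
proof -
  have "p \<in> sym_ideal scale" if "sym_class scale p = sym_ideal scale"
    using that additive_subgroup.zero_closed[OF ideal.axioms(1)[OF sym_ideal_ideal[of scale]]]
    unfolding sym_class_def a_r_coset_def' by auto
  moreover have "sym_class scale p = sym_ideal scale" if "p \<in> sym_ideal scale"
    unfolding sym_class_def
    using that by (intro abelian_group.a_coset_join2 additive_subgroup.a_subgroup
        ring.is_abelian_group ring_from_type_algebra ideal.axioms(1)[OF sym_ideal_ideal]) auto
  ultimately show ?thesis by (auto simp: Sym_def FactRing_def)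
qed

text \<open>The variable of the zero vector is a nonzero polynomial; the scaling relation for
  \<open>c = 0\<close> and \<open>w = 0\<close> puts it into the ideal.\<close>

lemma sym_class_poly_var_0:
  assumes "vector_space scale"
  shows "sym_class scale (poly_var 0) = \<zero>\<^bsub>Sym scale\<^esub>"
proof -
  interpret vector_space scale by fact
  let ?G = "{poly_var (v + w) - poly_var v - poly_var w |v w. True} \<union>
      {poly_var (scale c w) - poly_const c * poly_var w |c w. True}"
  have "?G \<subseteq> sym_ideal scale"
    unfolding sym_ideal_def by (rule ring.genideal_self) (auto intro: ring_from_type_algebra)
  moreover have "poly_var (scale 0 0) - poly_const 0 * poly_var 0 \<in> ?G" by blast
  ultimately show ?thesis by (auto simp: sym_class_eq_0_iff poly_const_def)
qed

text \<open>The kernel of the substitution is an ideal that contains both kinds of generators when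
  \<open>f\<close> is linear. Hence the substitution descends to \<open>Sym scale\<close>.\<close>

lemma poly_eval_sym_ideal:
  assumes add: "\<And>v w. f (v + w) = f v + f w" and scale: "\<And>c w. f (scale c w) = smult c (f w)"
    and p: "p \<in> sym_ideal scale"
  shows "poly_eval f p = 0"
proof -
  have "ring_hom_ring ring_of_type_algebra ring_of_type_algebra (poly_eval f)"
    by (rule ring_hom_ringI)
      (auto intro: ring_from_type_algebra simp: poly_eval_mult poly_eval_add)
  then have "ideal (a_kernel ring_of_type_algebra ring_of_type_algebra (poly_eval f))
      (ring_of_type_algebra :: ('a, 'b) vec_poly ring)"
    by (rule ring_hom_ring.kernel_is_ideal)
  then have "sym_ideal scale \<subseteq> a_kernel ring_of_type_algebra ring_of_type_algebra (poly_eval f)"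
    unfolding sym_ideal_def
    by (rule ring.genideal_minimal[OF ring_from_type_algebra])
      (auto simp: a_kernel_def' poly_eval_diff poly_eval_mult poly_eval_var poly_eval_const add scale)
  then show ?thesis using p by (auto simp: a_kernel_def')
qed

text \<open>Finitely many basis vectors span a subspace containing \<open>A\<close>; they are sent to distinct powers
  of the variable.\<close>
lemma exists_linear_to_poly:
  fixes scale :: "'k::field \<Rightarrow> 'w::ab_group_add \<Rightarrow> 'w"
  assumes "vector_space scale" "finite A"
  obtains f :: "'w \<Rightarrow> 'k poly" where "\<And>v w. f (v + w) = f v + f w" "\<And>c w. f (scale c w) = smult c (f w)"
    "\<And>w. w \<in> A \<Longrightarrow> f w = 0 \<Longrightarrow> w = 0"
proof -
  interpret vector_space scale by fact
  define E where "E = extend_basis {}"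
  have E: "independent E" "span E = UNIV"
    unfolding E_def using extend_basis_superset independent_extend_basis span_extend_basis independent_empty
    by blast+
  define B where "B = (\<Union>w\<in>A. {b. representation E w b \<noteq> 0})"
  have finB: "finite B" unfolding B_def using assms(2) finite_representation by auto
  obtain h :: "'w \<Rightarrow> nat" where h: "inj_on h B"
    using finite_imp_inj_to_nat_seg[OF finB] by blast
  \<comment> \<open>Basis vectors outside \<open>B\<close> are sent to 0, so \<open>f\<close> is
    linear on the whole space; members of \<open>A\<close> have no coordinates outside
    \<open>B\<close>.\<close>
  define f where "f = (\<lambda>w. \<Sum>b\<in>B. Polynomial.monom (representation E w b) (h b))"
  show ?thesis
  proof
    show "f (v + w) = f v + f w" for v w
      unfolding f_def using E by (simp add: representation_add add_monom[symmetric] sum.distrib)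
    show "f (scale c w) = smult c (f w)" for c w
      unfolding f_def using E
      by (intro poly_eqI) (auto simp: representation_scale coeff_sum sum_distrib_left intro!: sum.cong)
    fix w assume w: "w \<in> A" "f w = 0"
    have "representation E w b = 0" for b
    proof (cases "b \<in> B")
      case True
      \<comment> \<open>As \<open>h\<close> is injective on \<open>B\<close>, the coefficient at
        \<open>h b\<close> picks out the single coordinate of \<open>w\<close> at
        \<open>b\<close>.\<close>
      have "Polynomial.coeff (f w) (h b) = (\<Sum>b'\<in>B. if b' = b then representation E w b' else 0)"
        unfolding f_def coeff_sum using h True by (intro sum.cong) (auto dest: inj_onD)
      then show ?thesis using w(2) finB True by simp
    qed (use w(1) in \<open>auto simp: B_def\<close>)
    then show "w = 0" using sum_nonzero_representation_eq[OF E(1), of w] E(2) by simp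
  qed
qed

text \<open>A product in the ideal would be sent to 0 by every linear substitution; one that kills
  none of the factors contradicts the absence of zero divisors in \<open>'k poly\<close>.\<close>

lemma sym_class_prod_vars_nonzero:
  assumes "vector_space scale" "0 \<notin> set ws"
  shows "sym_class scale (prod_list (map poly_var ws)) \<noteq> \<zero>\<^bsub>Sym scale\<^esub>"
proof
  assume "sym_class scale (prod_list (map poly_var ws)) = \<zero>\<^bsub>Sym scale\<^esub>"
  then have *: "prod_list (map poly_var ws) \<in> sym_ideal scale" by (simp add: sym_class_eq_0_iff)
  obtain f :: "_ \<Rightarrow> _ poly" where f: "\<And>v w. f (v + w) = f v + f w" "\<And>c w. f (scale c w) = smult c (f w)"
    "\<And>w. w \<in> set ws \<Longrightarrow> f w = 0 \<Longrightarrow> w = 0"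
    by (rule exists_linear_to_poly[OF assms(1) finite_set]) blast
  have "poly_eval f (prod_list (map poly_var ws)) = 0" by (rule poly_eval_sym_ideal[OF f(1,2) *])
  then have "prod_list (map f ws) = 0" by (simp add: poly_eval_prod_list poly_eval_var o_def)
  then obtain w where "w \<in> set ws" "f w = 0" by (auto simp: prod_list_zero_iff)
  then show False using f(3) assms(2) by metis
qed

section \<open>Spans and products of subspaces\<close>

lemma sym_span_base:
  assumes "y \<in> Y" "y \<in> carrier (Sym scale)"
  shows "y \<in> sym_span scale Y"
proof -
  interpret cring "Sym scale" by (rule cring_Sym)
  have "sym_class scale (poly_const 1) = \<one>\<^bsub>Sym scale\<^esub>"
    using sym_class_1 by (simp add: poly_const_def)
  then show ?thesis
    using sym_span_step[OF assms(1) sym_span_zero, of scale 1] assms(2) by simp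
qed

lemma sym_span_trivial:
  assumes "Y \<subseteq> {\<zero>\<^bsub>Sym scale\<^esub>}"
  shows "sym_span scale Y = {\<zero>\<^bsub>Sym scale\<^esub>}"
proof -
  interpret cring "Sym scale" by (rule cring_Sym)
  have "y = \<zero>\<^bsub>Sym scale\<^esub>" if "y \<in> sym_span scale Y" for y
    using that by induction (use assms in auto)
  then show ?thesis using sym_span_zero by blast
qed

lemma sym_span_closed:
  assumes "Y \<subseteq> carrier (Sym scale)"
  shows "sym_span scale Y \<subseteq> carrier (Sym scale)"
proof
  interpret cring "Sym scale" by (rule cring_Sym)
  show "y \<in> carrier (Sym scale)" if "y \<in> sym_span scale Y" for y
    using that by induction (use assms in auto)
qed

lemma subspace_prod_list_closed:
  assumes "\<And>P. P \<in> set Ps \<Longrightarrow> P \<subseteq> carrier (Sym scale)"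
  shows "subspace_prod_list scale Ps \<subseteq> carrier (Sym scale)"
  using assms
proof (induction Ps)
  interpret cring "Sym scale" by (rule cring_Sym)
  {
    case Nil
    show ?case by (simp add: subspace_prod_list_def sym_span_closed)
  next
    case (Cons P Ps)
    then have "P \<subseteq> carrier (Sym scale)" "subspace_prod_list scale Ps \<subseteq> carrier (Sym scale)" by auto
    then show ?case
      unfolding subspace_prod_list_def by (auto simp: subspace_prod_def intro!: sym_span_closed)
  }
qed

text \<open>The carrier hypothesis lets a zero factor absorb the others, as the ring laws are
  available only there.\<close>

lemma subspace_prod_list_trivial:
  assumes "\<And>P. P \<in> set Ps \<Longrightarrow> P \<subseteq> carrier (Sym scale)" "{\<zero>\<^bsub>Sym scale\<^esub>} \<in> set Ps"
  shows "subspace_prod_list scale Ps = {\<zero>\<^bsub>Sym scale\<^esub>}"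
  using assms
proof (induction Ps)
  interpret cring "Sym scale" by (rule cring_Sym)
  {
    case Nil
    then show ?case by simp
  next
    case (Cons P Ps)
    have c: "P \<subseteq> carrier (Sym scale)" "subspace_prod_list scale Ps \<subseteq> carrier (Sym scale)"
      using Cons.prems(1) by (auto intro!: subspace_prod_list_closed)
    have "P = {\<zero>\<^bsub>Sym scale\<^esub>} \<or> subspace_prod_list scale Ps = {\<zero>\<^bsub>Sym scale\<^esub>}"
    proof (cases "{\<zero>\<^bsub>Sym scale\<^esub>} \<in> set Ps")
      case True
      have "Q \<subseteq> carrier (Sym scale)" if "Q \<in> set Ps" for Q using Cons.prems(1) that by simp
      then show ?thesis using Cons.IH True by simp
    qed (use Cons.prems(2) in simp)
    then have "{p \<otimes>\<^bsub>Sym scale\<^esub> q |p q. p \<in> P \<and> q \<in> subspace_prod_list scale Ps} \<subseteq> {\<zero>\<^bsub>Sym scale\<^esub>}"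
      using c by (auto simp: subset_iff)
    then show ?case
      using sym_span_trivial by (simp add: subspace_prod_list_def subspace_prod_def)
  }
qed

lemma prod_vars_in_subspace_prod_list:
  assumes "list_all2 (\<lambda>w V. w \<in> V) ws Vs"
  shows "sym_class scale (prod_list (map poly_var ws))
    \<in> subspace_prod_list scale (map (\<lambda>V. (\<lambda>w. sym_class scale (poly_var w)) ` V) Vs)"
  using assms
proof (induction rule: list_all2_induct)
  case Nil
  show ?case by (auto simp: subspace_prod_list_def sym_class_1 intro: sym_span_base
        simp flip: sym_class_1)
next
  case (Cons w ws V Vs)
  then show ?case
    by (auto simp: subspace_prod_list_def subspace_prod_def sym_class_mult[symmetric]
        intro!: sym_span_base) (auto simp: sym_class_mult)
qed

text \<open>If no factor is \<open>{0}\<close>, a nonzero vector is chosen from each; the product of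
  their classes lies in the product space and does not vanish.\<close>

lemma subspace_prod_list_trivial_iff:
  assumes "vector_space scale" "\<And>V. V \<in> set Vs \<Longrightarrow> 0 \<in> V"
  shows "subspace_prod_list scale (map (\<lambda>V. (\<lambda>w. sym_class scale (poly_var w)) ` V) Vs) = {\<zero>\<^bsub>Sym scale\<^esub>}
    \<longleftrightarrow> {0} \<in> set Vs" (is "?P = _ \<longleftrightarrow> _")
proof
  assume "{0} \<in> set Vs"
  then have "{\<zero>\<^bsub>Sym scale\<^esub>} \<in> set (map (\<lambda>V. (\<lambda>w. sym_class scale (poly_var w)) ` V) Vs)"
    using sym_class_poly_var_0[OF assms(1)] by (auto intro!: image_eqI[of _ _ "{0}"])
  then show "?P = {\<zero>\<^bsub>Sym scale\<^esub>}"
    by (intro subspace_prod_list_trivial) auto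
next
  assume P: "?P = {\<zero>\<^bsub>Sym scale\<^esub>}"
  show "{0} \<in> set Vs"
  proof (rule ccontr)
    assume "{0} \<notin> set Vs"
    then have "\<exists>w\<in>V. w \<noteq> 0" if "V \<in> set Vs" for V
      using assms(2)[OF that] that by (metis insertI1 singletonD subsetI subset_singletonD empty_iff)
    then obtain g where g: "\<And>V. V \<in> set Vs \<Longrightarrow> g V \<in> V \<and> g V \<noteq> 0" by metis
    have "list_all2 (\<lambda>w V. w \<in> V) (map g Vs) Vs"
      using g by (simp add: list_all2_map1 list_all2_same)
    then have "sym_class scale (prod_list (map poly_var (map g Vs))) \<in> ?P"
      by (rule prod_vars_in_subspace_prod_list)
    moreover have "sym_class scale (prod_list (map poly_var (map g Vs))) \<noteq> \<zero>\<^bsub>Sym scale\<^esub>"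
      by (rule sym_class_prod_vars_nonzero[OF assms(1)]) (use g in force)
    ultimately show False using P by blast
  qed
qed

section \<open>Represented matroids\<close>

context vector_space
begin

lemma independent_if_card_le_dim:
  assumes "finite B" "card B \<le> dim (span B)"
  shows "independent B"
proof
  assume "dependent B"
  then obtain x where x: "x \<in> B" "x \<in> span (B - {x})" by (auto simp: dependent_def)
  have "insert x (B - {x}) = B" using x(1) by auto
  then have "span B = span (B - {x})" using span_redundant[OF x(2)] by simp
  then have "dim (span B) \<le> card (B - {x})" using assms(1) by (intro dim_le_card) auto
  moreover have "card (B - {x}) < card B" using card_Diff1_less[OF assms(1) x(1)] .
  ultimately show False using assms(2) by linarith
qed

text \<open>Both sides say that \<open>B\<close> and \<open>C\<close> are disjoint with independent
  union. Forwards, a relation on the union yields a vector in both spans; backwards, the dimension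
  leaves no room for dependence or overlap.\<close>

lemma span_Int_trivial_iff:
  assumes fin: "finite B" "finite C" and ind: "independent B" "independent C"
  shows "span B \<inter> span C = {0} \<longleftrightarrow> dim (span (B \<union> C)) = card B + card C"
proof
  assume triv: "span B \<inter> span C = {0}"
  have disj: "B \<inter> C = {}"
  proof -
    have "x = 0" if "x \<in> B \<inter> C" for x using that triv span_base by blast
    then show ?thesis using ind(1) dependent_zero by blast
  qed
  have "independent (B \<union> C)"
  proof
    assume "dependent (B \<union> C)"
    then obtain u v where u: "v \<in> B \<union> C" "u v \<noteq> 0" "(\<Sum>w\<in>B \<union> C. scale (u w) w) = 0"
      using dependent_finite[of "B \<union> C"] fin by auto
    let ?a = "\<Sum>w\<in>B. scale (u w) w" and ?b = "\<Sum>w\<in>C. scale (u w) w"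
    have "?a + ?b = 0" using u(3) disj fin by (simp add: sum.union_disjoint)
    then have ab: "?a = - ?b" by (simp add: eq_neg_iff_add_eq_0)
    have "?a \<in> span B" "?b \<in> span C" by (intro span_sum span_scale span_base; assumption)+
    moreover from this have "?a \<in> span C" unfolding ab by (intro span_neg)
    ultimately have "?a = 0" using triv by blast
    moreover from this have "?b = 0" using ab by simp
    ultimately show False
      using u(1,2) independentD[OF ind(1) fin(1) order_refl, of u] independentD[OF ind(2) fin(2) order_refl, of u]
      by blast
  qed
  then show "dim (span (B \<union> C)) = card B + card C"
    using dim_span_eq_card_independent card_Un_disjoint[OF fin disj] by simp
next
  assume dim: "dim (span (B \<union> C)) = card B + card C"
  have le: "dim (span (B \<union> C)) \<le> card (B \<union> C)" using fin by (intro dim_le_card) auto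
  have disj: "B \<inter> C = {}" using le dim card_Un_Int[OF fin] fin by simp
  have "card (B \<union> C) \<le> dim (span (B \<union> C))" using dim card_Un_le[of B C] by simp
  then have indU: "independent (B \<union> C)" using fin by (intro independent_if_card_le_dim) auto
  have "v = 0" if v: "v \<in> span B" "v \<in> span C" for v
  proof -
    \<comment> \<open>Both are the coordinates of \<open>v\<close> over \<open>B \<union> C\<close>,
      so their support lies in \<open>B \<inter> C\<close>, which is empty.\<close>
    have "representation B v = representation C v"
      using representation_extend[OF indU v(1)] representation_extend[OF indU v(2)] by simp
    then have "representation B v b = 0" for b
      using representation_ne_zero[of B v b] representation_ne_zero[of C v b] disj by auto
    then show ?thesis using sum_nonzero_representation_eq[OF ind(1) v(1)] by simp
  qed
  then show "span B \<inter> span C = {0}" using span_zero by auto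
qed

end

section \<open>Ranks as dimensions\<close>

locale represented_matroid = matroid S indep + vector_space scale
  for S :: "'a set" and indep :: "'a set \<Rightarrow> bool"
    and scale :: "'k::field \<Rightarrow> 'w::ab_group_add \<Rightarrow> 'w" +
  fixes e :: "'a \<Rightarrow> 'u" and \<phi> :: "'u \<Rightarrow> 'w"
  assumes representation_\<phi>: "is_representation S indep scale e \<phi>"
begin

abbreviation g :: "'a \<Rightarrow> 'w" where "g \<equiv> \<lambda>a. \<phi> (e a)"

abbreviation V :: "'a set \<Rightarrow> 'w set" where "V \<equiv> V_sub scale e \<phi>"

lemma V_eq_span: "V A = span (g ` A)"
  unfolding V_sub_def setcompr_eq_image Collect_mem_eq ..

lemma indep_iff_dim: "A \<subseteq> S \<Longrightarrow> indep A \<longleftrightarrow> dim (span (g ` A)) = card A"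
  using representation_\<phi> unfolding is_representation_def V_eq_span by simp

text \<open>\<open>g\<close> may identify elements of \<open>S\<close>; on an independent set the
  dimension equals the number of elements, and since the number of images lies in between, neither a
  collision nor a linear relation is possible.\<close>

lemma indep_image:
  assumes "indep A"
  shows "card (g ` A) = card A" "independent (g ` A)"
proof -
  have fin: "finite A" by (rule finite_indep[OF assms])
  have d: "dim (span (g ` A)) = card A" using assms indep_iff_dim[OF indep_subset_ground[OF assms]] by simp
  moreover have "dim (span (g ` A)) \<le> card (g ` A)" using fin by (intro dim_le_card) auto
  moreover have "card (g ` A) \<le> card A" using fin by (rule card_image_le)
  ultimately show "card (g ` A) = card A" by linarith
  then show "independent (g ` A)" using d fin by (intro independent_if_card_le_dim) auto
qed

text \<open>If \<open>g a\<close> lay outside the span of the images of \<open>Y\<close>, adding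
  \<open>a\<close> to \<open>Y\<close> would give a larger independent subset of
  \<open>A\<close>.\<close>

lemma span_maximal_indep:
  assumes A: "A \<subseteq> S" and Y: "Y \<subseteq> A" "indep Y" "card Y = rank indep A"
  shows "span (g ` Y) = span (g ` A)"
proof (rule antisym)
  show "span (g ` Y) \<subseteq> span (g ` A)" by (intro span_mono image_mono Y(1))
  have "g a \<in> span (g ` Y)" if a: "a \<in> A" for a
  proof (rule ccontr)
    assume n: "g a \<notin> span (g ` Y)"
    then have na: "g a \<notin> g ` Y" using span_base[of "g a" "g ` Y"] by metis
    then have na': "a \<notin> Y" by (metis imageI)
    have fin: "finite Y" by (rule finite_indep[OF Y(2)])
    have "independent (insert (g a) (g ` Y))" using n indep_image(2)[OF Y(2)] by (rule independent_insertI)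
    then have "dim (span (g ` insert a Y)) = card (insert (g a) (g ` Y))"
      using dim_span_eq_card_independent by simp
    also have "\<dots> = card (insert a Y)" using na na' fin indep_image(1)[OF Y(2)] by simp
    finally have "indep (insert a Y)" using indep_iff_dim[of "insert a Y"] A Y(1) a by (simp add: subset_iff)
    then have "card (insert a Y) \<le> rank indep A" using Y(1) a by (intro card_le_rank[OF A]) (simp_all add: subset_iff)
    then show False using Y(3) na' fin by simp
  qed
  then show "span (g ` A) \<subseteq> span (g ` Y)" by (intro span_minimal image_subsetI subspace_span)
qed

text \<open>Maximal independent subsets of \<open>A\<close> and \<open>B\<close> have images that
  are bases of \<open>V A\<close> and \<open>V B\<close>, and
  \<open>rank indep (A \<union> B)\<close> is the dimension of the sum of these spaces;
  \<open>span_Int_trivial_iff\<close> then applies.\<close>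

lemma V_Int_trivial_iff:
  assumes "A \<subseteq> S" "B \<subseteq> S"
  shows "V A \<inter> V B = {0} \<longleftrightarrow> rank indep (A \<union> B) = rank indep A + rank indep B"
proof -
  obtain Y where Y: "Y \<subseteq> A" "indep Y" "card Y = rank indep A" using rank_attained[OF assms(1)] by auto
  obtain Z where Z: "Z \<subseteq> B" "indep Z" "card Z = rank indep B" using rank_attained[OF assms(2)] by auto
  have AB: "A \<union> B \<subseteq> S" using assms by auto
  obtain U where U: "U \<subseteq> A \<union> B" "indep U" "card U = rank indep (A \<union> B)"
    using rank_attained[OF AB] by auto
  have "dim (span (g ` (A \<union> B))) = rank indep (A \<union> B)"
    using span_maximal_indep[OF AB U] dim_span_eq_card_independent[OF indep_image(2)[OF U(2)]]
      indep_image(1)[OF U(2)] U(3) by simp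
  moreover have "span (g ` Y \<union> g ` Z) = span (g ` (A \<union> B))"
    unfolding image_Un span_Un span_maximal_indep[OF assms(1) Y] span_maximal_indep[OF assms(2) Z] ..
  moreover have "V A = span (g ` Y)" "V B = span (g ` Z)"
    unfolding V_eq_span
    using span_maximal_indep[OF assms(1) Y] span_maximal_indep[OF assms(2) Z] by simp_all
  moreover have "finite (g ` Y)" "finite (g ` Z)" using finite_indep Y(2) Z(2) by simp_all
  ultimately show ?thesis
    using span_Int_trivial_iff[OF _ _ indep_image(2)[OF Y(2)] indep_image(2)[OF Z(2)]]
      indep_image(1)[OF Y(2)] indep_image(1)[OF Z(2)] Y(3) Z(3)
    by simp
qed

text \<open>The product vanishes exactly when one factor does, and a factor vanishes exactly when
  its rank inequality fails. For a chain with one member the product is empty and is the line of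
  constants.\<close>

lemma chain_space_trivial_iff:
  assumes "Is \<in> chains S indep I"
  shows "chain_space scale e \<phi> Is = {\<zero>\<^bsub>Sym scale\<^esub>} \<longleftrightarrow> \<not> ear_chain Is"
proof -
  define W where "W = (\<lambda>i. V (Is ! i - Is ! (i - 1)) \<inter> V (Is ! (i - 1)))"
  have "chain_space scale e \<phi> Is =
      subspace_prod_list scale (map (\<lambda>U. (\<lambda>w. sym_class scale (poly_var w)) ` U) (map W [1..<length Is]))"
    unfolding chain_space_def W_def map_map o_def ..
  moreover have "0 \<in> U" if "U \<in> set (map W [1..<length Is])" for U
    using that by (auto simp: W_def V_eq_span span_zero)
  ultimately have "chain_space scale e \<phi> Is = {\<zero>\<^bsub>Sym scale\<^esub>} \<longleftrightarrow> {0} \<in> set (map W [1..<length Is])"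
    using subspace_prod_list_trivial_iff[OF vector_space_axioms] by metis
  also have "\<dots> \<longleftrightarrow> (\<exists>i\<in>{1..<length Is}. W i = {0})" by auto
  also have "\<dots> \<longleftrightarrow> \<not> ear_chain Is"
  proof -
    have "W i = {0} \<longleftrightarrow>
        \<not> rank indep (Is ! i) < rank indep (Is ! i - Is ! (i - 1)) + rank indep (Is ! (i - 1))"
      if i: "i \<in> {1..<length Is}" for i
    proof -
      have "Is ! i \<in> T_flats S indep i" using assms[unfolded chains_iff] i by simp
      then have sub: "Is ! i \<subseteq> S" by (simp add: T_flats_iff T_flat_iff)
      obtain j where j: "i = Suc j" using i by (cases i) auto
      then have inc: "Is ! (i - 1) \<subseteq> Is ! i" using assms[unfolded chains_iff] i by auto
      then have "Is ! i - Is ! (i - 1) \<union> Is ! (i - 1) = Is ! i" by auto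
      moreover have "Is ! i - Is ! (i - 1) \<subseteq> S" "Is ! (i - 1) \<subseteq> S" using sub inc by auto
      ultimately show ?thesis
        unfolding W_def using V_Int_trivial_iff[of "Is ! i - Is ! (i - 1)" "Is ! (i - 1)"]
          rank_Un_le[of "Is ! i - Is ! (i - 1)" "Is ! (i - 1)"] by auto
    qed
    then show ?thesis unfolding ear_chain_def by blast
  qed
  finally show ?thesis .
qed

text \<open>This excludes the empty set, so that a chain space inside the zero space is equal to
  it.\<close>

lemma zero_in_chain_space: "\<zero>\<^bsub>Sym scale\<^esub> \<in> chain_space scale e \<phi> Is"
proof -
  have "\<zero>\<^bsub>Sym scale\<^esub> \<in> subspace_prod_list scale Ps" for Ps
    by (cases Ps) (simp_all add: subspace_prod_list_def subspace_prod_def sym_span_zero)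
  then show ?thesis unfolding chain_space_def .
qed

text \<open>A sum of subspaces is zero exactly when every summand is, so the space is nonzero
  exactly when some chain is an ear chain; by \<open>connected_iff_ear_chain\<close> that is
  connectedness.\<close>

lemma multiplicity_space_trivial_iff:
  assumes "T_flat S indep I"
  shows "multiplicity_space S indep scale e \<phi> I = {\<zero>\<^bsub>Sym scale\<^esub>} \<longleftrightarrow> \<not> connected_in indep I"
proof -
  let ?Y = "\<Union>Is\<in>chains S indep I. chain_space scale e \<phi> Is"
  have Y: "?Y \<subseteq> carrier (Sym scale)"
    unfolding chain_space_def by (intro UN_least subspace_prod_list_closed) auto
  have "sym_span scale ?Y = {\<zero>\<^bsub>Sym scale\<^esub>} \<longleftrightarrow> ?Y \<subseteq> {\<zero>\<^bsub>Sym scale\<^esub>}"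
  proof
    assume "sym_span scale ?Y = {\<zero>\<^bsub>Sym scale\<^esub>}"
    then show "?Y \<subseteq> {\<zero>\<^bsub>Sym scale\<^esub>}" using sym_span_base[of _ ?Y scale] Y by blast
  qed (rule sym_span_trivial)
  also have "\<dots> \<longleftrightarrow> (\<forall>Is\<in>chains S indep I. chain_space scale e \<phi> Is = {\<zero>\<^bsub>Sym scale\<^esub>})"
    using zero_in_chain_space by blast
  also have "\<dots> \<longleftrightarrow> \<not> connected_in indep I"
    using connected_iff_ear_chain[OF assms] chain_space_trivial_iff by metis
  finally show ?thesis using assms by (simp add: multiplicity_space_def)
qed

end

theorem theorem10p5:
  fixes S I :: "'a set" and indep :: "'a set \<Rightarrow> bool"
    and scaleU :: "'k::field \<Rightarrow> 'u::ab_group_add \<Rightarrow> 'u"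
    and scaleW :: "'k \<Rightarrow> 'w::ab_group_add \<Rightarrow> 'w"
    and e :: "'a \<Rightarrow> 'u" and \<phi> :: "'u \<Rightarrow> 'w"
  assumes "matroid S indep"
    and "vector_space scaleU" and "indexed_basis scaleU S e"
    and "vector_space scaleW"
    and "Vector_Spaces.linear scaleU scaleW \<phi>"
    and "is_representation S indep scaleW e \<phi>"
    and "I \<subseteq> S"
  shows "multiplicity_space S indep scaleW e \<phi> I \<noteq> {\<zero>\<^bsub>Sym scaleW\<^esub>} \<longleftrightarrow>
         T_flat S indep I \<and> connected_in indep I"
proof (cases "T_flat S indep I")
  case True
  interpret represented_matroid S indep scaleW e \<phi>
    using assms(1,4,6) by (simp add: represented_matroid_def represented_matroid_axioms_def)
  show ?thesis using multiplicity_space_trivial_iff[OF True] True by simp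
\<comment> \<open>Outside the T-flats the multiplicity space is zero by definition.\<close>
qed (simp add: multiplicity_space_def)

end
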